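(* Let $(a_n)_{n\ge 1}$, $(b_n)_{n\ge 1}$ and $(f_n)_{n\ge 1}$ be sequences of complex numbers, and let $(y_n)_{n\ge -1}$ be the sequence of complex numbers determined by given initial values $y_{-1},y_0$ and the second order linear difference equation $$y_n-b_n y_{n-1}-a_n y_{n-2}=f_n,\qquad n\ge 1.$$ Assume that there exist sequences $(c_n)_{n\ge 1}$ and $(d_n)_{n\ge 1}$ of complex numbers satisfying $$c_n+d_{n+1}=b_n \quad\text{and}\quad c_n d_n=-a_n \qquad\text{for every } n\ge 1.$$ Then for every $n\ge 1$, $$y_{n}=\sum_{i=1}^{n+1} \left( \sum_{j=1}^{i-1} f_j \prod_{k=j+1}^{i-1} c_k+(y_0-d_1 y_{-1})\prod_{k=1}^{i-1} c_k\right) \prod_{j=i+1}^{n+1} d_j +y_{-1}\prod_{j=1}^{n+1} d_j .$$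
   Context: Empty sums are $0$ and empty products are $1$. *)

theory Defs
  imports Complex_Main
begin

end

(* The hypotheses on c and d factor the second order difference operator into first order ones: the
   quantity z n = y (n - 1) - d n * y (n - 2) satisfies z (n + 1) = c n * z n + f n.  The formula
   results from solving first this recurrence and then y (n - 1) = d n * y (n - 2) + z n. *)
theory Submission
  imports Defs
begin

text \<open>Stated for general coefficients because it is applied twice, to \<open>z\<close> with
  multipliers \<open>c\<close> and to \<open>y\<close> with multipliers \<open>d\<close>. In the
  induction, every old summand gains the factor \<open>h (Suc n)\<close>, and the new one,
  \<open>j = Suc n\<close>, has an empty product.\<close>

lemma first_order_recurrence_solution:
  fixes u g h :: "nat \<Rightarrow> 'a::comm_semiring_1"
  assumes step: "\<And>n. u (Suc n) = g (Suc n) + h (Suc n) * u n"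
  shows "u n = (\<Sum>j = 1..n. g j * (\<Prod>k = j+1..n. h k)) + u 0 * (\<Prod>k = 1..n. h k)"
proof (induction n)
  case 0
  show ?case by simp
next
  case (Suc n)
  have "(\<Sum>j = 1..n. g j * (\<Prod>k = j+1..Suc n. h k))
      = h (Suc n) * (\<Sum>j = 1..n. g j * (\<Prod>k = j+1..n. h k))"
    unfolding sum_distrib_left by (intro sum.cong) (auto simp: mult_ac)
  then have "(\<Sum>j = 1..Suc n. g j * (\<Prod>k = j+1..Suc n. h k))
      = g (Suc n) + h (Suc n) * (\<Sum>j = 1..n. g j * (\<Prod>k = j+1..n. h k))"
    by (simp add: add.commute)
  moreover have "u (Suc n) = g (Suc n) + h (Suc n)
      * ((\<Sum>j = 1..n. g j * (\<Prod>k = j+1..n. h k)) + u 0 * (\<Prod>k = 1..n. h k))"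
    using step Suc.IH by simp
  ultimately show ?case
    by (simp add: algebra_simps)
qed

theorem theorem1p1:
  fixes a b f c d :: "nat \<Rightarrow> complex" and y :: "int \<Rightarrow> complex"
  assumes rec: "\<And>n. n \<ge> 1 \<Longrightarrow> y (int n) - b n * y (int n - 1) - a n * y (int n - 2) = f n"
    and cd_sum: "\<And>n. n \<ge> 1 \<Longrightarrow> c n + d (n + 1) = b n"
    and cd_prod: "\<And>n. n \<ge> 1 \<Longrightarrow> c n * d n = - a n"
  shows "\<forall>n\<ge>1. y (int n) =
      (\<Sum>i = 1..n+1. ((\<Sum>j = 1..i-1. f j * (\<Prod>k = j+1..i-1. c k))
          + (y 0 - d 1 * y (-1)) * (\<Prod>k = 1..i-1. c k)) * (\<Prod>j = i+1..n+1. d j))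
      + y (-1) * (\<Prod>j = 1..n+1. d j)"
proof (intro allI impI)
  fix n :: nat
  define z where "z i = y (int i - 1) - d i * y (int i - 2)" for i
  have z_step: "z (Suc (Suc m)) = f (Suc m) + c (Suc m) * z (Suc m)" for m
  proof -
    have b: "b (Suc m) = c (Suc m) + d (Suc (Suc m))" and a: "a (Suc m) = - (c (Suc m) * d (Suc m))"
      using cd_sum[of "Suc m"] cd_prod[of "Suc m"] by simp_all
    \<comment> \<open>After substituting for \<open>a\<close> and \<open>b\<close>, the right-hand
      side regroups as \<open>z (Suc (Suc m)) - c (Suc m) * z (Suc m)\<close>.\<close>
    have "f (Suc m) = y (int m + 1) - b (Suc m) * y (int m) - a (Suc m) * y (int m - 1)"
      using rec[of "Suc m"] by (simp add: add.commute)
    then show ?thesis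
      by (simp add: z_def a b algebra_simps)
  qed
  have z: "z i = (\<Sum>j = 1..i-1. f j * (\<Prod>k = j+1..i-1. c k))
      + (y 0 - d 1 * y (-1)) * (\<Prod>k = 1..i-1. c k)" if "i \<ge> 1" for i
    \<comment> \<open>The shift makes \<open>z 1 = y 0 - d 1 * y (-1)\<close> the initial value;
      hence the upper bounds \<open>i-1\<close>.\<close>
    using first_order_recurrence_solution[of "\<lambda>m. z (Suc m)" f c "i - 1"] z_step that
    by (simp add: z_def)
  \<comment> \<open>Here the recurrence is the definition of \<open>z\<close> at
    \<open>Suc m\<close>. Starting from \<open>y (-1)\<close> at \<open>m = 0\<close> places
    \<open>y (int n)\<close> at \<open>m = n + 1\<close>.\<close>
  have "y (int m - 1) = (\<Sum>i = 1..m. z i * (\<Prod>j = i+1..m. d j)) + y (-1) * (\<Prod>j = 1..m. d j)" for m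
    using first_order_recurrence_solution[of "\<lambda>m. y (int m - 1)" z d m] by (simp add: z_def)
  from this[of "n + 1"]
  have "y (int n) = (\<Sum>i = 1..n+1. z i * (\<Prod>j = i+1..n+1. d j)) + y (-1) * (\<Prod>j = 1..n+1. d j)"
    by simp
  also have "(\<Sum>i = 1..n+1. z i * (\<Prod>j = i+1..n+1. d j)) =
      (\<Sum>i = 1..n+1. ((\<Sum>j = 1..i-1. f j * (\<Prod>k = j+1..i-1. c k))
          + (y 0 - d 1 * y (-1)) * (\<Prod>k = 1..i-1. c k)) * (\<Prod>j = i+1..n+1. d j))"
    \<comment> \<open>The closed form \<open>z\<close> requires \<open>i \<ge> 1\<close>, which
      membership in the summation range provides.\<close>
    by (intro sum.cong refl) (simp only: z atLeastAtMost_iff)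
  finally show "y (int n) =
      (\<Sum>i = 1..n+1. ((\<Sum>j = 1..i-1. f j * (\<Prod>k = j+1..i-1. c k))
          + (y 0 - d 1 * y (-1)) * (\<Prod>k = 1..i-1. c k)) * (\<Prod>j = i+1..n+1. d j))
      + y (-1) * (\<Prod>j = 1..n+1. d j)" .
qed

end
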